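(* Let $\phi$ be an ordering of the scenarios with $\rho_{\phi_1}\ge\dots\ge\rho_{\phi_{|S|}}$. If the partition $\mathcal{P}=\{P_1,\dots,P_{|\mathcal{P}|}\}$ of $S$ is created by a sequential assignment of the ordering given by $\phi$ into $|\mathcal{P}|=\lfloor\tau|S|\rfloor+1$ disjoint sets, i.e. scenario $\phi_i$ is assigned to the set $P_j$ with $j\equiv i \pmod{|\mathcal{P}|}$ for all $i\in\{1,\dots,|S|\}$, then $$v^{L}(\mathcal{P})\ge v_Q .$$
   Context: Setting. $S$ is a finite nonempty set of scenarios, $\tau\in[0,1]$ with $\lfloor\tau|S|\rfloor<|S|$, $\mathcal{X}\subseteq\mathbb{R}^n$, $f:\mathcal{X}\to\mathbb{R}$, and for each $s\in S$ a set $X^s\subseteq\mathbb{R}^n$ is given. All scenarios are equiprobable: $p_s=1/|S|$ for all $s\in S$. A partition $\mathcal{P}$ of $S$ is a collection of non-empty, pairwise disjoint subsets of $S$ whose union is $S$. For $P\subseteq S$ put $X^P=\bigcap_{s\in P}X^s$, and for $x\in\mathcal X$ put $z_P(x)=\mathbf{1}(x\in X^P)$. Partitioned model: $v^{L}(\mathcal{P})=\min\{f(x): x\in\mathcal{X},\ \sum_{P\in\mathcal{P}}q_P z_P(x)\ge\sum_{P\in\mathcal{P}}q_P-\tau\}$ with $q_P=\min_{s\in P}p_s$. Under equiprobability the constraint is equivalent to $\sum_{P\in\mathcal{P}}z_P(x)\ge|\mathcal{P}|-\lfloor\tau|S|\rfloor$. Scenario costs: $\rho_s=\min\{f(x): x\in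 X^s\cap\mathcal{X}\}$ for $s\in S$. A minimization problem is assumed to attain its minimum whenever it is feasible, and has value $+\infty$ if it is infeasible. Quantile bound: $v_Q=\rho_{\phi_q}$, where $q=\min\{k\in\{1,\dots,|S|\}:\sum_{l=1}^{k}p_{\phi_l}>\tau\}$. *)

theory Defs
  imports "HOL-Analysis.Analysis" "HOL-Library.Disjoint_Sets" "HOL-Number_Theory.Cong"
begin

text \<open>
  Optimal values are extended reals, so that an infeasible problem has value \<open>\<infinity>\<close>
  (the infimum of the empty set). The infimum is the minimum whenever the minimum is
  attained; see \<open>opt_value_eq_min\<close>.
\<close>

definition opt_value :: "('a \<Rightarrow> real) \<Rightarrow> 'a set \<Rightarrow> ereal" where
  "opt_value f F = (INF x\<in>F. ereal (f x))"

definition attains_min_if_feasible :: "('a \<Rightarrow> real) \<Rightarrow> 'a set \<Rightarrow> bool" where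
  "attains_min_if_feasible f F \<longleftrightarrow> (F \<noteq> {} \<longrightarrow> (\<exists>x. is_arg_min f (\<lambda>y. y \<in> F) x))"

lemma opt_value_infeasible: "opt_value f {} = \<infinity>"
  by (simp add: opt_value_def top_ereal_def)

lemma opt_value_eq_min:
  assumes "is_arg_min f (\<lambda>y. y \<in> F) x"
  shows "opt_value f F = ereal (f x)"
proof -
  have x: "x \<in> F" and min: "\<And>y. y \<in> F \<Longrightarrow> f x \<le> f y"
    using assms by (auto simp: is_arg_min_linorder)
  show ?thesis
    unfolding opt_value_def
    by (intro antisym INF_lower2[OF x] INF_greatest) (simp_all add: min)
qed

text \<open>
  Throughout, \<open>X\<close> is the deterministic feasible set, \<open>Xs s\<close> the feasible set of scenario \<open>s\<close>,
  \<open>p s\<close> its probability and \<open>f\<close> the objective, of which only the values on \<open>X\<close> are used.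
\<close>

definition part_prob :: "('s \<Rightarrow> real) \<Rightarrow> 's set \<Rightarrow> real" where
  "part_prob p P = Min (p ` P)"

definition part_ind :: "('s \<Rightarrow> 'a set) \<Rightarrow> 's set \<Rightarrow> 'a \<Rightarrow> real" where
  "part_ind Xs P = indicat_real (\<Inter>s\<in>P. Xs s)"

definition partitioned_feasible ::
    "'a set \<Rightarrow> ('s \<Rightarrow> 'a set) \<Rightarrow> ('s \<Rightarrow> real) \<Rightarrow> real \<Rightarrow> 's set set \<Rightarrow> 'a set" where
  "partitioned_feasible X Xs p \<tau> \<P> =
     {x \<in> X. (\<Sum>P\<in>\<P>. part_prob p P * part_ind Xs P x) \<ge> (\<Sum>P\<in>\<P>. part_prob p P) - \<tau>}"

definition v_L ::
    "('a \<Rightarrow> real) \<Rightarrow> 'a set \<Rightarrow> ('s \<Rightarrow> 'a set) \<Rightarrow> ('s \<Rightarrow> real) \<Rightarrow> real \<Rightarrow> 's set set \<Rightarrow> ereal" where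
  "v_L f X Xs p \<tau> \<P> = opt_value f (partitioned_feasible X Xs p \<tau> \<P>)"

definition scenario_cost :: "('a \<Rightarrow> real) \<Rightarrow> 'a set \<Rightarrow> ('s \<Rightarrow> 'a set) \<Rightarrow> 's \<Rightarrow> ereal" where
  "scenario_cost f X Xs s = opt_value f (Xs s \<inter> X)"

text \<open>An ordering of \<open>S\<close> is an enumeration \<open>\<phi>\<close> indexed by \<open>1, \<dots>, card S\<close>.\<close>

definition quantile_index :: "'s set \<Rightarrow> ('s \<Rightarrow> real) \<Rightarrow> real \<Rightarrow> (nat \<Rightarrow> 's) \<Rightarrow> nat" where
  "quantile_index S p \<tau> \<phi> = Min {k \<in> {1..card S}. (\<Sum>l=1..k. p (\<phi> l)) > \<tau>}"

definition v_Q ::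
    "'s set \<Rightarrow> ('a \<Rightarrow> real) \<Rightarrow> 'a set \<Rightarrow> ('s \<Rightarrow> 'a set) \<Rightarrow> ('s \<Rightarrow> real) \<Rightarrow> real \<Rightarrow> (nat \<Rightarrow> 's) \<Rightarrow> ereal"
  where
  "v_Q S f X Xs p \<tau> \<phi> = scenario_cost f X Xs (\<phi> (quantile_index S p \<tau> \<phi>))"

definition sequential_part :: "(nat \<Rightarrow> 's) \<Rightarrow> nat \<Rightarrow> nat \<Rightarrow> nat \<Rightarrow> 's set" where
  "sequential_part \<phi> N m j = {\<phi> i | i. i \<in> {1..N} \<and> [j = i] (mod m)}"

definition sequential_partition :: "(nat \<Rightarrow> 's) \<Rightarrow> nat \<Rightarrow> nat \<Rightarrow> 's set set" where
  "sequential_partition \<phi> N m = sequential_part \<phi> N m ` {1..m}"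

lemma cong_imp_eq_in_1_to_m:
  fixes j k m :: nat
  assumes "j \<in> {1..m}" "k \<in> {1..m}" "[j = k] (mod m)"
  shows "j = k"
proof -
  have "[j - 1 = k - 1] (mod m)"
    using assms cong_diff_nat[of j k m 1 1] by auto
  then have "j - 1 = k - 1"
    using assms by (auto simp: cong_def)
  then show ?thesis using assms by auto
qed

lemma sequential_partition_is_partition:
  assumes \<phi>: "bij_betw \<phi> {1..N} S" and m: "1 \<le> m" "m \<le> N"
  shows "partition_on S (sequential_partition \<phi> N m)"
    and "card (sequential_partition \<phi> N m) = m"
proof -
  have inj: "inj_on \<phi> {1..N}" and im: "\<phi> ` {1..N} = S"
    using \<phi> by (auto simp: bij_betw_def)
  have mem: "\<phi> j \<in> sequential_part \<phi> N m j" if "j \<in> {1..m}" for j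
    using that m unfolding sequential_part_def by (auto intro!: exI[of _ j])
  have disj: "j = k"
    if jk: "j \<in> {1..m}" "k \<in> {1..m}" "s \<in> sequential_part \<phi> N m j" "s \<in> sequential_part \<phi> N m k"
    for j k s
  proof -
    obtain a b where ab: "s = \<phi> a" "a \<in> {1..N}" "[j = a] (mod m)"
        "s = \<phi> b" "b \<in> {1..N}" "[k = b] (mod m)"
      using jk unfolding sequential_part_def by blast
    then have "a = b" using inj by (metis inj_onD)
    then have "[j = k] (mod m)" using ab by (auto simp: cong_def)
    then show ?thesis using jk cong_imp_eq_in_1_to_m by blast
  qed
  have "s \<in> \<Union>(sequential_partition \<phi> N m)" if "s \<in> S" for s
  proof -
    obtain i where i: "i \<in> {1..N}" "s = \<phi> i" using \<open>s \<in> S\<close> im by blast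
    define j where "j = (i - 1) mod m + 1"
    have "j mod m = ((i - 1) + 1) mod m" unfolding j_def by (rule mod_add_left_eq)
    then have "[j = i] (mod m)" using i by (simp add: cong_def)
    moreover have "j \<in> {1..m}" using m by (simp add: j_def Suc_leI)
    ultimately show ?thesis
      using i unfolding sequential_partition_def sequential_part_def by blast
  qed
  moreover have "\<Union>(sequential_partition \<phi> N m) \<subseteq> S"
    using im unfolding sequential_partition_def sequential_part_def by blast
  ultimately have "\<Union>(sequential_partition \<phi> N m) = S" by blast
  moreover have "disjoint (sequential_partition \<phi> N m)"
    unfolding disjoint_def sequential_partition_def using disj by blast
  moreover have "{} \<notin> sequential_partition \<phi> N m"
    unfolding sequential_partition_def using mem by blast
  ultimately show "partition_on S (sequential_partition \<phi> N m)"
    by (auto simp: partition_on_def)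
  have "inj_on (sequential_part \<phi> N m) {1..m}"
    using mem disj by (metis inj_onI)
  then show "card (sequential_partition \<phi> N m) = m"
    by (simp add: sequential_partition_def card_image)
qed

end

theory Submission
  imports Defs
begin

text \<open>
  The proof is a pigeonhole count. With \<open>m = \<lfloor>\<tau> N\<rfloor> + 1\<close> blocks of weight \<open>1 / N\<close> each, the
  blocks together weigh \<open>m / N > \<tau>\<close>, so a feasible point cannot afford to miss all of them: it
  satisfies every scenario of some block (\<open>feasible_satisfies_some_block\<close>). The sequential
  assignment puts exactly one of the \<open>m\<close> most expensive scenarios \<open>\<phi> 1, \<dots>, \<phi> m\<close> into each
  block, so whichever block it is, the point satisfies some \<open>\<phi> j\<close> with \<open>j \<le> m\<close> and hence costs
  at least as much as \<open>\<phi> m\<close>. For equal probabilities the quantile index is that same \<open>m\<close>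
  (\<open>quantile_index_equiprobable\<close>).
\<close>

text \<open>Missing every block would mean losing the whole block weight, more than the
  tolerance \<open>\<tau>\<close>.\<close>

lemma feasible_satisfies_some_block:
  assumes x: "x \<in> partitioned_feasible X Xs p \<tau> \<P>"
    and weight: "(\<Sum>P\<in>\<P>. part_prob p P) > \<tau>"
  shows "\<exists>P\<in>\<P>. x \<in> (\<Inter>s\<in>P. Xs s)"
proof (rule ccontr)
  assume "\<not> ?thesis"
  then have "(\<Sum>P\<in>\<P>. part_prob p P * part_ind Xs P x) = 0"
    by (intro sum.neutral) (auto simp: part_ind_def indicator_def)
  then show False
    using x weight by (simp add: partitioned_feasible_def)
qed

lemma part_prob_const:
  assumes "P \<noteq> {}" "\<And>s. s \<in> P \<Longrightarrow> p s = c"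
  shows "part_prob p P = c"
proof -
  have "p ` P = {c}" using assms by force
  then show ?thesis by (simp add: part_prob_def)
qed

text \<open>This bounds the cost of satisfying a block from below: however the later scenarios are
  dealt out, every block holds one of the \<open>m\<close> most expensive ones.\<close>

lemma leader_in_sequential_part:
  assumes "j \<in> {1..m}" "m \<le> N"
  shows "\<phi> j \<in> sequential_part \<phi> N m j"
  using assms unfolding sequential_part_def by (auto intro!: exI[of _ j])

text \<open>The first \<open>k\<close> scenarios have total probability \<open>k / N\<close>, which exceeds \<open>\<tau>\<close> exactly
  when the integer \<open>k\<close> exceeds \<open>\<tau> N\<close>.\<close>

lemma quantile_index_equiprobable:
  assumes \<tau>: "0 \<le> \<tau>" and lt: "\<lfloor>\<tau> * real (card S)\<rfloor> < int (card S)"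
    and p: "\<And>s. s \<in> S \<Longrightarrow> p s = 1 / real (card S)"
    and \<phi>: "\<phi> ` {1..card S} \<subseteq> S"
  shows "quantile_index S p \<tau> \<phi> = nat \<lfloor>\<tau> * real (card S)\<rfloor> + 1"
proof -
  let ?N = "card S" and ?m = "nat \<lfloor>\<tau> * real (card S)\<rfloor> + 1"
  have fl: "0 \<le> \<lfloor>\<tau> * real ?N\<rfloor>" using \<tau> by simp
  have N: "0 < ?N" using lt fl by linarith
  have "(\<Sum>l=1..k. p (\<phi> l)) > \<tau> \<longleftrightarrow> ?m \<le> k" if k: "k \<in> {1..?N}" for k
  proof -
    have "(\<Sum>l=1..k. p (\<phi> l)) = (\<Sum>l=1..k. 1 / real ?N)"
      using k \<phi> by (intro sum.cong refl p) auto
    also have "\<dots> = real k / real ?N" by simp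
    finally have "(\<Sum>l=1..k. p (\<phi> l)) > \<tau> \<longleftrightarrow> \<tau> * real ?N < of_int (int k)"
      using N by (simp only: pos_less_divide_eq of_nat_0_less_iff of_int_of_nat_eq)
    also have "\<dots> \<longleftrightarrow> \<lfloor>\<tau> * real ?N\<rfloor> < int k"
      by (rule floor_less_iff [symmetric])
    also have "\<dots> \<longleftrightarrow> ?m \<le> k"
      using fl by linarith
    finally show ?thesis .
  qed
  then have "{k \<in> {1..?N}. (\<Sum>l=1..k. p (\<phi> l)) > \<tau>} = {?m..?N}" by auto
  moreover have "?m \<le> ?N" using lt fl by linarith
  ultimately show ?thesis
    unfolding quantile_index_def by (intro Min_eqI) (simp_all only: finite_atLeastAtMost atLeastAtMost_iff order_refl)
qed

theorem proposition12:
  fixes S :: "'s set" and p :: "'s \<Rightarrow> real" and \<tau> :: real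
    and X :: "(real ^ 'n) set" and f :: "real ^ 'n \<Rightarrow> real" and Xs :: "'s \<Rightarrow> (real ^ 'n) set"
    and \<phi> :: "nat \<Rightarrow> 's" and \<P> :: "'s set set"
  assumes "finite S" and "S \<noteq> {}"
    and "0 \<le> \<tau>" and "\<tau> \<le> 1" and "\<lfloor>\<tau> * real (card S)\<rfloor> < int (card S)"
    and "\<And>s. s \<in> S \<Longrightarrow> p s = 1 / real (card S)"
    and "\<And>s. s \<in> S \<Longrightarrow> attains_min_if_feasible f (Xs s \<inter> X)"
    and "attains_min_if_feasible f (partitioned_feasible X Xs p \<tau> \<P>)"
    and "bij_betw \<phi> {1..card S} S"
    and "\<And>i j. 1 \<le> i \<Longrightarrow> i \<le> j \<Longrightarrow> j \<le> card S
           \<Longrightarrow> scenario_cost f X Xs (\<phi> i) \<ge> scenario_cost f X Xs (\<phi> j)"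
    and "\<P> = sequential_partition \<phi> (card S) (nat \<lfloor>\<tau> * real (card S)\<rfloor> + 1)"
  shows "v_L f X Xs p \<tau> \<P> \<ge> v_Q S f X Xs p \<tau> \<phi>"
proof -
  let ?N = "card S"
  define m where "m = nat \<lfloor>\<tau> * real ?N\<rfloor> + 1"
  have P_eq: "\<P> = sequential_partition \<phi> ?N m"
    using assms(11) by (simp add: m_def)
  have fl: "0 \<le> \<lfloor>\<tau> * real ?N\<rfloor>" using assms(3) by simp
  have m: "1 \<le> m" "m \<le> ?N" using assms(5) fl unfolding m_def by linarith+
  have m_gt: "\<tau> * real ?N < real m" using fl unfolding m_def by linarith
  have part: "partition_on S \<P>" and card: "card \<P> = m"
    unfolding P_eq by (rule sequential_partition_is_partition[OF assms(9) m])+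
  have "part_prob p P = 1 / real ?N" if "P \<in> \<P>" for P
    using that part assms(6) by (intro part_prob_const) (auto simp: partition_on_def)
  then have "(\<Sum>P\<in>\<P>. part_prob p P) = real m / real ?N"
    by (simp add: card)
  moreover have "\<tau> < real m / real ?N"
    using m m_gt by (simp add: pos_less_divide_eq)
  ultimately have weight: "(\<Sum>P\<in>\<P>. part_prob p P) > \<tau>" by (simp only:)
  have "scenario_cost f X Xs (\<phi> m) \<le> ereal (f x)"
    if x: "x \<in> partitioned_feasible X Xs p \<tau> \<P>" for x
  proof -
    obtain j where j: "j \<in> {1..m}" and xj: "x \<in> (\<Inter>s\<in>sequential_part \<phi> ?N m j. Xs s)"
      using feasible_satisfies_some_block[OF x weight]
      unfolding P_eq sequential_partition_def by blast
    have "x \<in> Xs (\<phi> j) \<inter> X"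
      using xj leader_in_sequential_part[OF j m(2)] x by (auto simp: partitioned_feasible_def)
    then have "scenario_cost f X Xs (\<phi> j) \<le> ereal (f x)"
      unfolding scenario_cost_def opt_value_def by (rule INF_lower)
    moreover have "scenario_cost f X Xs (\<phi> m) \<le> scenario_cost f X Xs (\<phi> j)"
      using j m(2) by (intro assms(10)) auto
    ultimately show ?thesis by (rule order_trans[rotated])
  qed
  moreover have "quantile_index S p \<tau> \<phi> = m"
    unfolding m_def using assms(3,5,6,9)
    by (intro quantile_index_equiprobable) (auto simp: bij_betw_def)
  ultimately show ?thesis
    unfolding v_L_def v_Q_def opt_value_def by (simp only: INF_greatest)
qed

end
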